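(* If a sequent $S$ is derivable in $\mathbf{GA_s}$, then $\models_{\mathbf{A}} S$.
   Context: Formulas are built from propositional variables and $t$ using $+,\to,\Rightarrow$ (binary) and $\lnot$; a valuation $v$ into $\mathbb{Q}$ satisfies $v(t)=0$, $v(A+B)=v(A)+v(B)$, $v(\lnot A)=-v(A)$, $v(A\to B)=v(B)-v(A)$, $v(A\Rightarrow B)=\min(0,v(B)-v(A))$ (i.e. $A\Rightarrow B=(A\to B)\land t$). A sequent $\Gamma\vdash\Delta$ is a pair of finite multisets of formulas; $\models_{\mathbf{A}}\Gamma\vdash\Delta$ means $\sum_{A\in\Gamma}v(A)\le\sum_{B\in\Delta}v(B)$ for every valuation $v$ (empty sum $0$), equivalently $(\sum\Gamma)\to(\sum\Delta)$ is valid in all lattice-ordered abelian groups. Calculus $\mathbf{GA_s}$ (premise(s) / conclusion; commas are multiset union): axioms $A\vdash A$ and $\vdash$; (W) $\Gamma\vdash\Delta/\Gamma,A\Rightarrow B\vdash\Delta$; (M) premises $\Gamma_1\vdash\Delta_1$ and $\Gamma_2\vdash\Delta_2$, conclusion $\Gamma_1,\Gamma_2\vdash\Delta_1,\Delta_2$; (C) from $\Gamma,\ldots,\Gamma\vdash\Delta,\ldots,\Delta$ ($n$ copies of each, $n>0$) infer $\Gamma\vdash\Delta$; $(t,l)$ $\Gamma\vdash\Delta/\Gamma,t\vdash\Delta$; $(t,r)$ $\Gamma\vdash\Delta/\Gamma\vdash t,\Delta$; $(\lnot,l)$ $\Gamma\vdash A,\Delta/\Gamma,\lnot A\vdash\Delta$;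 $(\lnot,r)$ $\Gamma,A\vdash\Delta/\Gamma\vdash\lnot A,\Delta$; $(\to,l)$ $\Gamma,B\vdash A,\Delta/\Gamma,A\to B\vdash\Delta$; $(\to,r)$ $\Gamma,A\vdash B,\Delta/\Gamma\vdash A\to B,\Delta$; $(+,l)$ $\Gamma,A,B\vdash\Delta/\Gamma,A+B\vdash\Delta$; $(+,r)$ $\Gamma\vdash A,B,\Delta/\Gamma\vdash A+B,\Delta$; $(\Rightarrow,l)$ $\Gamma,B,B\Rightarrow A\vdash\Delta,A/\Gamma,A\Rightarrow B\vdash\Delta$; $(\Rightarrow,r)$ premises $\Gamma\vdash\Delta$ and $\Gamma,A\vdash\Delta,B$, conclusion $\Gamma\vdash\Delta,A\Rightarrow B$. *)

theory Defs
  imports Complex_Main "HOL-Library.Multiset"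
begin

datatype 'p fm =
    Var 'p
  | Truth  (\<open>\<^bold>t\<close>)
  | Neg "'p fm"  (\<open>\<^bold>\<not> _\<close> [80] 80)
  | Plus "'p fm" "'p fm"  (infixl \<open>\<^bold>+\<close> 75)
  | Imp "'p fm" "'p fm"  (infixr \<open>\<^bold>\<rightarrow>\<close> 70)
  | SImp "'p fm" "'p fm"  (infixr \<open>\<^bold>\<Rightarrow>\<close> 70)

definition valuation :: "('p fm \<Rightarrow> rat) \<Rightarrow> bool" where
  "valuation v \<longleftrightarrow>
     v \<^bold>t = 0 \<and>
     (\<forall>A B. v (A \<^bold>+ B) = v A + v B) \<and>
     (\<forall>A. v (\<^bold>\<not> A) = - v A) \<and>
     (\<forall>A B. v (A \<^bold>\<rightarrow> B) = v B - v A) \<and>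
     (\<forall>A B. v (A \<^bold>\<Rightarrow> B) = min 0 (v B - v A))"

type_synonym 'p sequent = "'p fm multiset \<times> 'p fm multiset"

abbreviation seq :: "'p fm multiset \<Rightarrow> 'p fm multiset \<Rightarrow> 'p sequent"  (infix \<open>\<turnstile>\<close> 55) where
  "\<Gamma> \<turnstile> \<Delta> \<equiv> (\<Gamma>, \<Delta>)"

definition valid_A :: "'p sequent \<Rightarrow> bool"  (\<open>\<Turnstile>\<^sub>A _\<close> [50] 50) where
  "\<Turnstile>\<^sub>A S \<longleftrightarrow>
     (\<forall>v. valuation v \<longrightarrow> (\<Sum>A\<in>#fst S. v A) \<le> (\<Sum>B\<in>#snd S. v B))"

inductive GAs :: "'p sequent \<Rightarrow> bool" where
  ax_id: "GAs ({#A#} \<turnstile> {#A#})"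
| ax_empty: "GAs ({#} \<turnstile> {#})"
| W: "GAs (\<Gamma> \<turnstile> \<Delta>) \<Longrightarrow> GAs (\<Gamma> + {#A \<^bold>\<Rightarrow> B#} \<turnstile> \<Delta>)"
| M: "GAs (\<Gamma>\<^sub>1 \<turnstile> \<Delta>\<^sub>1) \<Longrightarrow> GAs (\<Gamma>\<^sub>2 \<turnstile> \<Delta>\<^sub>2) \<Longrightarrow> GAs (\<Gamma>\<^sub>1 + \<Gamma>\<^sub>2 \<turnstile> \<Delta>\<^sub>1 + \<Delta>\<^sub>2)"
| C: "n > 0 \<Longrightarrow> GAs (repeat_mset n \<Gamma> \<turnstile> repeat_mset n \<Delta>) \<Longrightarrow> GAs (\<Gamma> \<turnstile> \<Delta>)"
| t_l: "GAs (\<Gamma> \<turnstile> \<Delta>) \<Longrightarrow> GAs (\<Gamma> + {#\<^bold>t#} \<turnstile> \<Delta>)"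
| t_r: "GAs (\<Gamma> \<turnstile> \<Delta>) \<Longrightarrow> GAs (\<Gamma> \<turnstile> {#\<^bold>t#} + \<Delta>)"
| neg_l: "GAs (\<Gamma> \<turnstile> {#A#} + \<Delta>) \<Longrightarrow> GAs (\<Gamma> + {#\<^bold>\<not> A#} \<turnstile> \<Delta>)"
| neg_r: "GAs (\<Gamma> + {#A#} \<turnstile> \<Delta>) \<Longrightarrow> GAs (\<Gamma> \<turnstile> {#\<^bold>\<not> A#} + \<Delta>)"
| imp_l: "GAs (\<Gamma> + {#B#} \<turnstile> {#A#} + \<Delta>) \<Longrightarrow> GAs (\<Gamma> + {#A \<^bold>\<rightarrow> B#} \<turnstile> \<Delta>)"
| imp_r: "GAs (\<Gamma> + {#A#} \<turnstile> {#B#} + \<Delta>) \<Longrightarrow> GAs (\<Gamma> \<turnstile> {#A \<^bold>\<rightarrow> B#} + \<Delta>)"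
| plus_l: "GAs (\<Gamma> + {#A, B#} \<turnstile> \<Delta>) \<Longrightarrow> GAs (\<Gamma> + {#A \<^bold>+ B#} \<turnstile> \<Delta>)"
| plus_r: "GAs (\<Gamma> \<turnstile> {#A, B#} + \<Delta>) \<Longrightarrow> GAs (\<Gamma> \<turnstile> {#A \<^bold>+ B#} + \<Delta>)"
| simp_l: "GAs (\<Gamma> + {#B, B \<^bold>\<Rightarrow> A#} \<turnstile> \<Delta> + {#A#}) \<Longrightarrow> GAs (\<Gamma> + {#A \<^bold>\<Rightarrow> B#} \<turnstile> \<Delta>)"
| simp_r: "GAs (\<Gamma> \<turnstile> \<Delta>) \<Longrightarrow> GAs (\<Gamma> + {#A#} \<turnstile> \<Delta> + {#B#}) \<Longrightarrow> GAs (\<Gamma> \<turnstile> \<Delta> + {#A \<^bold>\<Rightarrow> B#})"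

end

theory Submission
  imports Defs
begin

text \<open>Soundness by induction on the derivation: for each fixed valuation, every rule preserves
  the inequality of sums. Contraction rests on \<open>sum_image_repeat_mset\<close>.\<close>

lemma sum_image_repeat_mset:
  fixes f :: "'a \<Rightarrow> 'b::comm_semiring_1"
  shows "(\<Sum>x\<in>#repeat_mset n M. f x) = of_nat n * (\<Sum>x\<in>#M. f x)"
  by (induction n) (simp_all add: algebra_simps)

theorem mainTheorem18:
  fixes S :: "'p sequent"
  assumes "GAs S"
  shows "\<Turnstile>\<^sub>A S"
  unfolding valid_A_def
proof (intro allI impI)
  fix v :: "'p fm \<Rightarrow> rat"
  assume "valuation v"
  then have v: "v \<^bold>t = 0" "v (A \<^bold>+ B) = v A + v B" "v (\<^bold>\<not> A) = - v A"
    "v (A \<^bold>\<rightarrow> B) = v B - v A" "v (A \<^bold>\<Rightarrow> B) = min 0 (v B - v A)" for A B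
    unfolding valuation_def by blast+
  from assms show "(\<Sum>A\<in>#fst S. v A) \<le> (\<Sum>B\<in>#snd S. v B)"
  proof (induction rule: GAs.induct)
    \<comment> \<open>Both sums are multiplied by \<open>n\<close>, which cancels as
      \<open>n > 0\<close>.\<close>
    case (C n \<Gamma> \<Delta>)
    then show ?case by (simp add: sum_image_repeat_mset)
  \<comment> \<open>With x = \<open>v B - v A\<close>, \<open>simp_l\<close> is the identity min 0 x
    = x + min 0 (-x); in \<open>simp_r\<close> the two premises bound the two arguments of
    min.\<close>
  qed (auto simp: v min_def split: if_splits)
qed

end
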